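(* Let $M$ be a monoid containing elements $a$ and $b$ such that (1) for all $u,v\in M$, if $uba^n=vba^m$ holds for some $m,n\ge0$, then $uba^n=vba^n$ also holds; (2) for each $i\ge1$ there exist $u_i,v_i\in M$ such that $u_iba^i=v_iba^i$ but $u_iba^{i-1}\neq v_iba^{i-1}$. Then $M$ is not left coherent.
   Context: A left $S$-act over a monoid $S$ is a set with a unital associative left action of $S$. It is finitely presented if it is isomorphic to a quotient of a free left $S$-act on a finite set by a finitely generated left $S$-act congruence. A monoid $S$ is left coherent if every finitely generated subact of every finitely presented left $S$-act is finitely presented. *)

theory Defs
  imports "HOL-Algebra.Group" "HOL.Hull"
begin

locale left_act = monoid S for S (structure) +
  fixes A :: "'b set" and act :: "'a \<Rightarrow> 'b \<Rightarrow> 'b"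
  assumes act_closed: "\<lbrakk>s \<in> carrier S; x \<in> A\<rbrakk> \<Longrightarrow> act s x \<in> A"
    and act_one: "x \<in> A \<Longrightarrow> act \<one> x = x"
    and act_mult: "\<lbrakk>s \<in> carrier S; t \<in> carrier S; x \<in> A\<rbrakk> \<Longrightarrow> act (s \<otimes> t) x = act s (act t x)"

definition act_iso ::
  "('a, 'm) monoid_scheme \<Rightarrow> 'b set \<Rightarrow> ('a \<Rightarrow> 'b \<Rightarrow> 'b) \<Rightarrow> 'c set \<Rightarrow> ('a \<Rightarrow> 'c \<Rightarrow> 'c) \<Rightarrow> ('b \<Rightarrow> 'c) \<Rightarrow> bool"
  where "act_iso S A act A' act' f \<longleftrightarrow>
    bij_betw f A A' \<and> (\<forall>s\<in>carrier S. \<forall>x\<in>A. f (act s x) = act' s (f x))"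

definition act_isomorphic ::
  "('a, 'm) monoid_scheme \<Rightarrow> 'b set \<Rightarrow> ('a \<Rightarrow> 'b \<Rightarrow> 'b) \<Rightarrow> 'c set \<Rightarrow> ('a \<Rightarrow> 'c \<Rightarrow> 'c) \<Rightarrow> bool"
  where "act_isomorphic S A act A' act' \<longleftrightarrow> (\<exists>f. act_iso S A act A' act' f)"

definition act_congruence ::
  "('a, 'm) monoid_scheme \<Rightarrow> 'b set \<Rightarrow> ('a \<Rightarrow> 'b \<Rightarrow> 'b) \<Rightarrow> ('b \<times> 'b) set \<Rightarrow> bool"
  where "act_congruence S A act r \<longleftrightarrow>
    equiv A r \<and> (\<forall>s\<in>carrier S. \<forall>(x, y)\<in>r. (act s x, act s y) \<in> r)"

definition fg_act_congruence ::
  "('a, 'm) monoid_scheme \<Rightarrow> 'b set \<Rightarrow> ('a \<Rightarrow> 'b \<Rightarrow> 'b) \<Rightarrow> ('b \<times> 'b) set \<Rightarrow> bool"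
  where "fg_act_congruence S A act r \<longleftrightarrow>
    (\<exists>H. finite H \<and> H \<subseteq> A \<times> A \<and> r = act_congruence S A act hull H)"

text \<open>On a congruence class \<open>r `` {x}\<close> of a congruence \<open>r\<close> this takes the value \<open>r `` {act s x}\<close>.\<close>

definition quotient_act :: "('a \<Rightarrow> 'b \<Rightarrow> 'b) \<Rightarrow> ('b \<times> 'b) set \<Rightarrow> 'a \<Rightarrow> 'b set \<Rightarrow> 'b set"
  where "quotient_act act r s C = r `` (act s ` C)"

text \<open>The free left act on \<open>X\<close> has carrier \<open>X \<times> carrier S\<close>, the pair \<open>(x, t)\<close> standing for \<open>t x\<close>.\<close>

definition free_act :: "('a, 'm) monoid_scheme \<Rightarrow> 'a \<Rightarrow> 'x \<times> 'a \<Rightarrow> 'x \<times> 'a"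
  where "free_act S s = (\<lambda>(x, t). (x, s \<otimes>\<^bsub>S\<^esub> t))"

text \<open>Since only isomorphism types matter, finite free generating sets are taken inside \<open>nat\<close>.\<close>

definition finitely_presented_act ::
  "('a, 'm) monoid_scheme \<Rightarrow> 'b set \<Rightarrow> ('a \<Rightarrow> 'b \<Rightarrow> 'b) \<Rightarrow> bool"
  where "finitely_presented_act S A act \<longleftrightarrow> left_act S A act \<and>
    (\<exists>(X :: nat set) r. finite X \<and> fg_act_congruence S (X \<times> carrier S) (free_act S) r \<and>
      act_isomorphic S A act ((X \<times> carrier S) // r) (quotient_act (free_act S) r))"

definition fg_subact ::
  "('a, 'm) monoid_scheme \<Rightarrow> 'b set \<Rightarrow> ('a \<Rightarrow> 'b \<Rightarrow> 'b) \<Rightarrow> 'b set \<Rightarrow> bool"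
  where "fg_subact S A act B \<longleftrightarrow>
    (\<exists>Y. finite Y \<and> Y \<subseteq> A \<and> B = {act s y | s y. s \<in> carrier S \<and> y \<in> Y})"

text \<open>
  A definition cannot quantify over all types, so the acts range over carriers in the type
  \<open>(nat \<times> 'a) set\<close>, which contains an isomorphic copy of every finitely presented act.
  That nothing is lost is the content of \<open>left_coherentD\<close> below, where the carrier type is arbitrary.
\<close>

definition left_coherent :: "('a, 'm) monoid_scheme \<Rightarrow> bool"
  where "left_coherent S \<longleftrightarrow>
    (\<forall>(A :: (nat \<times> 'a) set set) act B.
      finitely_presented_act S A act \<longrightarrow> fg_subact S A act B \<longrightarrow> finitely_presented_act S B act)"

lemma left_act_fg_subact:
  assumes "left_act S A act" and "fg_subact S A act B"
  shows "left_act S B act" and "B \<subseteq> A"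
proof -
  interpret left_act S A act by fact
  obtain Y where Y: "Y \<subseteq> A" "B = {act s y | s y. s \<in> carrier S \<and> y \<in> Y}"
    using assms(2) unfolding fg_subact_def by blast
  show BA: "B \<subseteq> A" using Y act_closed by auto
  show "left_act S B act"
  proof unfold_locales
    fix s x assume s: "s \<in> carrier S" and "x \<in> B"
    then obtain t y where t: "t \<in> carrier S" "y \<in> Y" "x = act t y" using Y by auto
    then have "act s x = act (s \<otimes>\<^bsub>S\<^esub> t) y" using s Y act_mult by auto
    then show "act s x \<in> B" using s t Y by blast
  qed (use BA act_one act_mult in auto)
qed

lemma left_act_iso:
  assumes "left_act S A act" and f: "act_iso S A act A' act' f"
  shows "left_act S A' act'"
proof -
  interpret left_act S A act by fact
  have im: "A' = f ` A" and eq: "\<And>s x. \<lbrakk>s \<in> carrier S; x \<in> A\<rbrakk> \<Longrightarrow> act' s (f x) = f (act s x)"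
    using f unfolding act_iso_def bij_betw_def by auto
  show ?thesis
    by unfold_locales (auto simp: im eq act_closed act_one act_mult)
qed

lemma left_coherentD:
  fixes A :: "'b set"
  assumes coh: "left_coherent S" and fp: "finitely_presented_act S A act"
    and fg: "fg_subact S A act B"
  shows "finitely_presented_act S B act"
proof -
  obtain X :: "nat set" and r f where X: "finite X"
      and r: "fg_act_congruence S (X \<times> carrier S) (free_act S) r"
      and f: "act_iso S A act ((X \<times> carrier S) // r) (quotient_act (free_act S) r) f"
    using fp unfolding finitely_presented_act_def act_isomorphic_def by blast
  define Q where "Q = (X \<times> carrier S) // r"
  define q where "q = quotient_act (free_act S) r"
  have A: "left_act S A act" using fp unfolding finitely_presented_act_def by blast
  have fQ: "act_iso S A act Q q f" using f unfolding Q_def q_def .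
  have "left_act S Q q" by (rule left_act_iso[OF A fQ])
  moreover have "act_isomorphic S Q q Q q"
    unfolding act_isomorphic_def act_iso_def by (intro exI[of _ id]) auto
  ultimately have fpQ: "finitely_presented_act S Q q"
    using X r unfolding finitely_presented_act_def Q_def q_def by blast
  have B: "left_act S B act" and BA: "B \<subseteq> A" using left_act_fg_subact[OF A fg] by auto
  have eq: "\<And>s x. \<lbrakk>s \<in> carrier S; x \<in> A\<rbrakk> \<Longrightarrow> f (act s x) = q s (f x)"
    and im: "f ` A = Q" and inj: "inj_on f A"
    using fQ unfolding act_iso_def bij_betw_def by auto
  obtain Y where Y: "finite Y" "Y \<subseteq> A" "B = {act s y | s y. s \<in> carrier S \<and> y \<in> Y}"
    using fg unfolding fg_subact_def by blast
  have "f ` B = {q s y | s y. s \<in> carrier S \<and> y \<in> f ` Y}"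
  proof (intro equalityI subsetI)
    fix z assume "z \<in> f ` B"
    then obtain s y where sy: "s \<in> carrier S" "y \<in> Y" "z = f (act s y)" unfolding Y(3) by blast
    then have "z = q s (f y)" using eq Y(2) by blast
    then show "z \<in> {q s y | s y. s \<in> carrier S \<and> y \<in> f ` Y}" using sy by blast
  next
    fix z assume "z \<in> {q s y | s y. s \<in> carrier S \<and> y \<in> f ` Y}"
    then obtain s y where sy: "s \<in> carrier S" "y \<in> Y" "z = q s (f y)" by blast
    then have "z = f (act s y)" using eq Y(2) by (metis subsetD)
    moreover have "act s y \<in> B" using sy Y(3) by blast
    ultimately show "z \<in> f ` B" by blast
  qed
  then have "fg_subact S Q q (f ` B)"
    unfolding fg_subact_def
    by (intro exI[of _ "f ` Y"] conjI finite_imageI image_mono[OF Y(2), of f, unfolded im] Y(1))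
  then have "finitely_presented_act S (f ` B) q"
    using coh fpQ unfolding left_coherent_def by blast
  then obtain X' :: "nat set" and r' g where X': "finite X'"
      and r': "fg_act_congruence S (X' \<times> carrier S) (free_act S) r'"
      and g: "act_iso S (f ` B) q ((X' \<times> carrier S) // r') (quotient_act (free_act S) r') g"
    unfolding finitely_presented_act_def act_isomorphic_def by blast
  have "bij_betw f B (f ` B)" using inj BA by (meson inj_on_subset inj_on_imp_bij_betw)
  then have "bij_betw (g \<circ> f) B ((X' \<times> carrier S) // r')"
    using g unfolding act_iso_def by (blast intro: bij_betw_trans)
  moreover have "(g \<circ> f) (act s x) = quotient_act (free_act S) r' s ((g \<circ> f) x)"
    if "s \<in> carrier S" "x \<in> B" for s x
  proof -
    have "g (q s (f x)) = quotient_act (free_act S) r' s (g (f x))"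
      using g that unfolding act_iso_def by blast
    then show ?thesis using eq[of s x] that BA by (simp add: subset_iff)
  qed
  ultimately have "act_iso S B act ((X' \<times> carrier S) // r') (quotient_act (free_act S) r') (g \<circ> f)"
    unfolding act_iso_def by blast
  then show ?thesis
    using B X' r' unfolding finitely_presented_act_def act_isomorphic_def by blast
qed

end

theory Submission imports Defs begin

text \<open>
  Write \<open>\<rho>\<close> for the left congruence on \<open>M\<close> generated by the single pair \<open>(1, a)\<close>, so that \<open>M / \<rho>\<close>
  is finitely presented. Explicitly, \<open>s \<rho> t\<close> holds iff \<open>s a\<^sup>n = t a\<^sup>m\<close> for some \<open>m\<close> and \<open>n\<close>
  (\<open>identify_one_iff\<close>). The subact generated by the class \<open>y\<close> of \<open>b\<close> is cyclic, and two elements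
  \<open>u\<close>, \<open>v\<close> of \<open>M\<close> agree on \<open>y\<close> iff \<open>u b a\<^sup>n = v b a\<^sup>m\<close> for some \<open>m\<close> and \<open>n\<close>. By the first hypothesis
  on \<open>a\<close> and \<open>b\<close> one may take \<open>m = n\<close> here. Hence the annihilator congruence of \<open>y\<close> is the union of the
  ascending chain of left congruences \<open>\<kappa>\<^sub>n = {(u, v). u b a\<^sup>n = v b a\<^sup>n}\<close>, and the second hypothesis
  says that this chain is strictly ascending.

  If the cyclic subact were finitely presented, then its annihilator congruence would be finitely
  generated, so the chain would have to stabilise. This is \<open>annihilator_chain_stabilises\<close>; the point
  there is that finite presentability is witnessed by some finite generating set that may have nothing
  to do with \<open>y\<close>.
\<close>

section \<open>Quotients of acts\<close>

lemma act_congruenceI: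
  assumes "r \<subseteq> A \<times> A" and "refl_on A r" and "sym r" and "trans r"
    and "\<And>s x y. \<lbrakk>s \<in> carrier S; (x, y) \<in> r\<rbrakk> \<Longrightarrow> (act s x, act s y) \<in> r"
  shows "act_congruence S A act r"
proof -
  have "(act s (fst p), act s (snd p)) \<in> r" if "s \<in> carrier S" "p \<in> r" for s p
    by (rule assms(5)[OF that(1)]) (simp add: that(2))
  then show ?thesis
    unfolding act_congruence_def case_prod_unfold
    by (intro conjI ballI equivI assms(1-4))
qed

lemma act_congruence_hull:
  assumes "left_act S A act" and H: "H \<subseteq> A \<times> A"
  shows "act_congruence S A act (act_congruence S A act hull H)"
proof -
  interpret left_act S A act by fact
  let ?r = "act_congruence S A act hull H"
  \<comment> \<open>The total relation keeps the hull inside \<open>A \<times> A\<close>: an intersection of no congruences at all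
    would be the universal relation on the type.\<close>
  have total: "act_congruence S A act (A \<times> A)"
    unfolding act_congruence_def equiv_def refl_on_def sym_def trans_def
    using act_closed by auto
  have ge: "p \<in> ?r" if "\<And>t. \<lbrakk>act_congruence S A act t; H \<subseteq> t\<rbrakk> \<Longrightarrow> p \<in> t" for p
    using that unfolding hull_def by auto
  have le: "p \<in> t" if "p \<in> ?r" "act_congruence S A act t" "H \<subseteq> t" for p t
    using that unfolding hull_def by auto
  have equiv_t: "refl_on A t" "sym t" "trans t" if "act_congruence S A act t" for t
    using that by (auto simp: act_congruence_def equiv_def)
  have "?r \<subseteq> A \<times> A"
    by (rule hull_minimal) (rule H, rule total)
  moreover have "refl_on A ?r"
    by (auto simp: refl_on_def intro!: ge dest: equiv_t(1))
  moreover have "sym ?r"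
    by (rule symI, rule ge) (blast intro: le symD[OF equiv_t(2)])
  moreover have "trans ?r"
    by (rule transI, rule ge) (blast intro: le transD[OF equiv_t(3)])
  moreover have "(act s x, act s x') \<in> ?r" if "s \<in> carrier S" "(x, x') \<in> ?r" for s x x'
  proof (rule ge)
    fix t assume t: "act_congruence S A act t" "H \<subseteq> t"
    then have "(x, x') \<in> t" using le that(2) by blast
    then show "(act s x, act s x') \<in> t" using t(1) that(1) unfolding act_congruence_def by blast
  qed
  ultimately show ?thesis by (rule act_congruenceI)
qed

lemma quotient_act_class:
  assumes r: "act_congruence S A act r" and s: "s \<in> carrier S" and x: "x \<in> A"
  shows "quotient_act act r s (r `` {x}) = r `` {act s x}"
proof -
  have eq: "equiv A r" and comp: "\<And>x x'. (x, x') \<in> r \<Longrightarrow> (act s x, act s x') \<in> r"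
    using r s unfolding act_congruence_def by auto
  have "(x, x) \<in> r" using eq x by (auto simp: equiv_def refl_on_def)
  moreover have "trans r" using eq by (auto simp: equiv_def)
  ultimately show ?thesis
    unfolding quotient_act_def using comp by (auto dest: transD)
qed

lemma left_act_quotient:
  assumes "left_act S A act" and r: "act_congruence S A act r"
  shows "left_act S (A // r) (quotient_act act r)"
proof -
  interpret left_act S A act by fact
  show ?thesis
    by unfold_locales
      (auto simp: quotient_act_class[OF r] act_closed act_one act_mult elim!: quotientE intro!: quotientI)
qed

lemma left_act_free:
  assumes "monoid S"
  shows "left_act S (X \<times> carrier S) (free_act S)"
proof -
  interpret monoid S by fact
  show ?thesis by unfold_locales (auto simp: free_act_def m_assoc)
qed

lemma finitely_presented_quotient_free:
  fixes X :: "nat set"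
  assumes "monoid S" and "finite X" and "fg_act_congruence S (X \<times> carrier S) (free_act S) r"
  shows "finitely_presented_act S ((X \<times> carrier S) // r) (quotient_act (free_act S) r)"
proof -
  have free: "left_act S (X \<times> carrier S) (free_act S)"
    by (rule left_act_free) fact
  then have "act_congruence S (X \<times> carrier S) (free_act S) r"
    using assms(3) act_congruence_hull unfolding fg_act_congruence_def by blast
  then have "left_act S ((X \<times> carrier S) // r) (quotient_act (free_act S) r)"
    by (rule left_act_quotient[OF free])
  moreover have "act_isomorphic S ((X \<times> carrier S) // r) (quotient_act (free_act S) r)
      ((X \<times> carrier S) // r) (quotient_act (free_act S) r)"
    unfolding act_isomorphic_def act_iso_def by (intro exI[of _ id]) auto
  ultimately show ?thesis
    using assms(2,3) unfolding finitely_presented_act_def by blast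
qed

section \<open>Annihilators in finitely presented cyclic acts\<close>

text \<open>
  Let \<open>B\<close> be presented by generators \<open>x \<in> X\<close> and a finite set \<open>H\<close> of relations, and write the
  generator \<open>x\<close> as \<open>\<sigma> x\<close> times \<open>y\<close>. Pulling \<open>\<kappa> n\<close> back along \<open>(x, s) \<mapsto> s \<sigma>(x)\<close> gives a chain
  of congruences on the free act, and the finitely many relations in \<open>H\<close> all lie in the \<open>N\<close>-th of them,
  which therefore contains every relation of \<open>B\<close>. To return from \<open>X\<close> to \<open>y\<close>, write \<open>y\<close> as \<open>t\<^sub>0\<close> times the
  generator \<open>x\<^sub>0\<close>. Then \<open>t\<^sub>0 \<sigma>(x\<^sub>0)\<close> fixes \<open>y\<close>, and this one extra relation lies in
  some \<open>\<kappa> K\<close> with \<open>K \<ge> N\<close>. If \<open>u y = v y\<close>, then modulo \<open>\<kappa> K\<close> the elements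
  \<open>u\<close>, \<open>u t\<^sub>0 \<sigma>(x\<^sub>0)\<close>, \<open>v t\<^sub>0 \<sigma>(x\<^sub>0)\<close> and \<open>v\<close> are all congruent.
\<close>

lemma annihilator_chain_stabilises:
  fixes S :: "('a, 'm) monoid_scheme" (structure) and \<kappa> :: "nat \<Rightarrow> ('a \<times> 'a) set"
  assumes fp: "finitely_presented_act S B act"
    and y: "y \<in> B" and cyclic: "B = {act s y | s. s \<in> carrier S}"
    and cong: "\<And>n. act_congruence S (carrier S) (mult S) (\<kappa> n)"
    and chain: "mono \<kappa>"
    and ann: "\<And>s t. \<lbrakk>s \<in> carrier S; t \<in> carrier S; act s y = act t y\<rbrakk> \<Longrightarrow> \<exists>n. (s, t) \<in> \<kappa> n"
  shows "\<exists>K. \<forall>s\<in>carrier S. \<forall>t\<in>carrier S. act s y = act t y \<longrightarrow> (s, t) \<in> \<kappa> K"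
proof -
  obtain X :: "nat set" and r f where B: "left_act S B act"
      and r: "fg_act_congruence S (X \<times> carrier S) (free_act S) r"
      and f: "act_iso S B act ((X \<times> carrier S) // r) (quotient_act (free_act S) r) f"
    using fp unfolding finitely_presented_act_def act_isomorphic_def by blast
  interpret left_act S B act by fact
  let ?F = "X \<times> carrier S"
  let ?class = "\<lambda>x s. r `` {(x, s)}"
  obtain H where H: "finite H" "H \<subseteq> ?F \<times> ?F" "r = act_congruence S ?F (free_act S) hull H"
    using r unfolding fg_act_congruence_def by blast
  have congr: "act_congruence S ?F (free_act S) r"
    unfolding H(3) by (rule act_congruence_hull[OF left_act_free[OF monoid_axioms] H(2)])
  then have eqr: "equiv ?F r" unfolding act_congruence_def by blast
  have inj: "inj_on f B" and im: "f ` B = ?F // r"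
    and hom: "\<And>s z. \<lbrakk>s \<in> carrier S; z \<in> B\<rbrakk> \<Longrightarrow> f (act s z) = quotient_act (free_act S) r s (f z)"
    using f unfolding act_iso_def bij_betw_def by auto
  have q_class: "quotient_act (free_act S) r s (?class x t) = ?class x (s \<otimes> t)"
    if "s \<in> carrier S" "x \<in> X" "t \<in> carrier S" for s t x
    using quotient_act_class[OF congr that(1), of "(x, t)"] that by (simp add: free_act_def)

  have "\<exists>s. s \<in> carrier S \<and> f (act s y) = ?class x \<one>" if "x \<in> X" for x
  proof -
    have "?class x \<one> \<in> f ` B" unfolding im using that by (auto intro: quotientI)
    then obtain z where "z \<in> B" "f z = ?class x \<one>" by auto
    then show ?thesis using cyclic by blast
  qed
  then obtain \<sigma> where \<sigma>: "\<And>x. x \<in> X \<Longrightarrow> \<sigma> x \<in> carrier S"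
      and f\<sigma>: "\<And>x. x \<in> X \<Longrightarrow> f (act (\<sigma> x) y) = ?class x \<one>"
    by metis
  have f_word: "f (act (s \<otimes> \<sigma> x) y) = ?class x s" if "x \<in> X" "s \<in> carrier S" for x s
    using that \<sigma>[OF that(1)] y hom[of s "act (\<sigma> x) y"]
    by (simp add: act_mult act_closed f\<sigma> q_class)

  define R where
    "R n = {((x, s), (x', s')). (x, s) \<in> ?F \<and> (x', s') \<in> ?F \<and> (s \<otimes> \<sigma> x, s' \<otimes> \<sigma> x') \<in> \<kappa> n}" for n
  have R_cong: "act_congruence S ?F (free_act S) (R n)" for n
  proof -
    have k: "equiv (carrier S) (\<kappa> n)"
      and kc: "\<And>s t t'. \<lbrakk>s \<in> carrier S; (t, t') \<in> \<kappa> n\<rbrakk> \<Longrightarrow> (s \<otimes> t, s \<otimes> t') \<in> \<kappa> n"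
      using cong[of n] unfolding act_congruence_def by auto
    have "R n \<subseteq> ?F \<times> ?F" unfolding R_def by auto
    moreover have "refl_on ?F (R n)"
      using k \<sigma> unfolding R_def equiv_def refl_on_def by auto
    moreover have "sym (R n)"
      using k unfolding R_def equiv_def sym_def by auto
    moreover have "trans (R n)"
      using k unfolding R_def equiv_def trans_def by blast
    moreover have "(free_act S s p, free_act S s p') \<in> R n"
      if "s \<in> carrier S" "(p, p') \<in> R n" for s p p'
      using that kc \<sigma> unfolding R_def free_act_def by (auto simp: m_assoc)
    ultimately show ?thesis by (rule act_congruenceI)
  qed

  have "\<exists>n. p \<in> R n" if p: "p \<in> H" for p
  proof -
    obtain x s x' s' where p_eq: "p = ((x, s), (x', s'))" and mem: "(x, s) \<in> ?F" "(x', s') \<in> ?F"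
      using subsetD[OF H(2) p] by auto
    have "p \<in> r" using p hull_subset[of H] unfolding H(3) by blast
    then have "?class x s = ?class x' s'"
      using equiv_class_eq[OF eqr] p_eq by simp
    then have "f (act (s \<otimes> \<sigma> x) y) = f (act (s' \<otimes> \<sigma> x') y)"
      using f_word mem by auto
    then have "act (s \<otimes> \<sigma> x) y = act (s' \<otimes> \<sigma> x') y"
      by (rule inj_onD[OF inj]) (use mem \<sigma> y in \<open>auto intro!: act_closed\<close>)
    then show ?thesis using ann mem \<sigma> unfolding R_def p_eq by auto
  qed
  moreover have "R m \<subseteq> R n" if "m \<le> n" for m n
    using monoD[OF chain that] unfolding R_def by auto
  ultimately have "\<forall>p\<in>H. eventually (\<lambda>n. p \<in> R n) sequentially"
    unfolding eventually_sequentially by blast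
  then have "eventually (\<lambda>n. \<forall>p\<in>H. p \<in> R n) sequentially"
    by (rule eventually_ball_finite[OF H(1)])
  then obtain N where "H \<subseteq> R N"
    unfolding eventually_sequentially by blast
  then have r_le: "r \<subseteq> R N"
    unfolding H(3) by (rule hull_minimal) (rule R_cong)

  have "f y \<in> ?F // r" using y im by blast
  then obtain x0 t0 where x0: "x0 \<in> X" "t0 \<in> carrier S" and fy: "f y = ?class x0 t0"
    by (auto elim!: quotientE)
  define w where "w = t0 \<otimes> \<sigma> x0"
  have w: "w \<in> carrier S" using x0 \<sigma> unfolding w_def by simp
  have "f (act w y) = f y" using f_word x0 fy unfolding w_def by simp
  then have "act w y = y"
    by (rule inj_onD[OF inj]) (use w y act_closed in auto)
  then have "act w y = act \<one> y"
    using y by (simp add: act_one)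
  then obtain m where "(w, \<one>) \<in> \<kappa> m" using ann w by blast
  then obtain K where K: "(w, \<one>) \<in> \<kappa> K" "N \<le> K"
    using monoD[OF chain, of m "max m N"] by (metis max.cobounded1 max.cobounded2 subsetD)
  have kK: "equiv (carrier S) (\<kappa> K)"
    and kc: "\<And>s t t'. \<lbrakk>s \<in> carrier S; (t, t') \<in> \<kappa> K\<rbrakk> \<Longrightarrow> (s \<otimes> t, s \<otimes> t') \<in> \<kappa> K"
    using cong[of K] unfolding act_congruence_def by auto
  have "(u, v) \<in> \<kappa> K" if uv: "u \<in> carrier S" "v \<in> carrier S" "act u y = act v y" for u v
  proof -
    have "?class x0 (u \<otimes> t0) = ?class x0 (v \<otimes> t0)"
      using hom[of u y] hom[of v y] uv y x0 by (simp add: fy q_class)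
    then have "((x0, u \<otimes> t0), (x0, v \<otimes> t0)) \<in> r"
      using eq_equiv_class[OF _ eqr] uv x0 by simp
    then have "(u \<otimes> t0 \<otimes> \<sigma> x0, v \<otimes> t0 \<otimes> \<sigma> x0) \<in> \<kappa> N"
      using r_le unfolding R_def by blast
    then have "(u \<otimes> w, v \<otimes> w) \<in> \<kappa> K"
      using monoD[OF chain K(2)] uv x0 \<sigma> unfolding w_def by (auto simp: m_assoc)
    moreover have "(u \<otimes> w, u) \<in> \<kappa> K" "(v \<otimes> w, v) \<in> \<kappa> K"
      using kc[OF uv(1) K(1)] kc[OF uv(2) K(1)] uv by auto
    ultimately show ?thesis
      using equiv_class_eq_iff[OF kK] by metis
  qed
  then show ?thesis by blast
qed

section \<open>The congruence generated by identifying \<open>a\<close> with the identity\<close>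

text \<open>
  The relation on the right is transitive because powers of \<open>a\<close> commute: from \<open>s a\<^sup>n = t a\<^sup>m\<close> and
  \<open>t a\<^sup>k = u a\<^sup>l\<close> one gets \<open>s a\<^sup>n\<^sup>+\<^sup>k = u a\<^sup>l\<^sup>+\<^sup>m\<close>. It is thus a left congruence; conversely a congruence
  that relates \<open>1\<close> to \<open>a\<close> relates \<open>s\<close> to each \<open>s a\<^sup>n\<close>.
\<close>

lemma identify_one_iff:
  fixes S :: "('a, 'm) monoid_scheme" (structure) and x :: 'x
  assumes "monoid S" and a: "a \<in> carrier S" and s: "s \<in> carrier S" and t: "t \<in> carrier S"
  shows "((x, s), (x, t)) \<in> act_congruence S ({x} \<times> carrier S) (free_act S) hull {((x, \<one>), (x, a))}
    \<longleftrightarrow> (\<exists>(m::nat) (n::nat). s \<otimes> a [^] n = t \<otimes> a [^] m)"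
    (is "_ \<in> ?r \<longleftrightarrow> _")
proof -
  interpret monoid S by fact
  let ?F = "{x} \<times> carrier S"
  define R where "R = {((x', s), (x'', t)). x' = x \<and> x'' = x \<and> s \<in> carrier S \<and> t \<in> carrier S
    \<and> (\<exists>(m::nat) (n::nat). s \<otimes> a [^] n = t \<otimes> a [^] m)}"
  have "R \<subseteq> ?F \<times> ?F" unfolding R_def by auto
  moreover have "refl_on ?F R" unfolding R_def refl_on_def by auto
  moreover have "sym R"
  proof (rule symI)
    fix p q assume "(p, q) \<in> R"
    then obtain s t and m n :: nat where eqs: "p = (x, s)" "q = (x, t)"
      and car: "s \<in> carrier S" "t \<in> carrier S" and st: "s \<otimes> a [^] n = t \<otimes> a [^] m"
      unfolding R_def by auto
    show "(q, p) \<in> R" using car st[symmetric] unfolding R_def eqs by blast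
  qed
  moreover have "trans R"
  proof (rule transI)
    fix p q q' assume "(p, q) \<in> R" "(q, q') \<in> R"
    then obtain s t u and k l m n :: nat where eqs: "p = (x, s)" "q = (x, t)" "q' = (x, u)"
      and car: "s \<in> carrier S" "t \<in> carrier S" "u \<in> carrier S"
      and st: "s \<otimes> a [^] n = t \<otimes> a [^] m" and tu: "t \<otimes> a [^] k = u \<otimes> a [^] l"
      unfolding R_def by auto
    have "s \<otimes> a [^] (n + k) = (s \<otimes> a [^] n) \<otimes> a [^] k"
      using a car by (simp add: m_assoc nat_pow_mult)
    also have "\<dots> = t \<otimes> a [^] (m + k)"
      using a car by (simp add: st m_assoc nat_pow_mult)
    also have "\<dots> = (t \<otimes> a [^] k) \<otimes> a [^] m"
      using a car by (simp add: m_assoc nat_pow_mult add.commute)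
    also have "\<dots> = u \<otimes> a [^] (l + m)"
      using a car by (simp add: tu m_assoc nat_pow_mult)
    finally show "(p, q') \<in> R" using car unfolding R_def eqs by blast
  qed
  moreover have "(free_act S s p, free_act S s q) \<in> R"
    if s: "s \<in> carrier S" and pq: "(p, q) \<in> R" for s p q
  proof -
    obtain t u and m n :: nat where eqs: "p = (x, t)" "q = (x, u)"
      and car: "t \<in> carrier S" "u \<in> carrier S" and tu: "t \<otimes> a [^] n = u \<otimes> a [^] m"
      using pq unfolding R_def by auto
    have "(s \<otimes> t) \<otimes> a [^] n = (s \<otimes> u) \<otimes> a [^] m"
      using s car a tu by (simp add: m_assoc)
    then show ?thesis using s car unfolding R_def eqs free_act_def by auto
  qed
  ultimately have R_cong: "act_congruence S ?F (free_act S) R" by (rule act_congruenceI)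
  have "\<one> \<otimes> a [^] (1::nat) = a \<otimes> a [^] (0::nat)" using a by simp
  then have "((x, \<one>), (x, a)) \<in> R"
    using a unfolding R_def by blast
  then have r_le: "?r \<subseteq> R" by (intro hull_minimal R_cong) simp

  have r_cong: "act_congruence S ?F (free_act S) ?r"
    by (rule act_congruence_hull[OF left_act_free[OF monoid_axioms]]) (use a in auto)
  then have eqr: "equiv ?F ?r"
    and comp: "\<And>s p q. \<lbrakk>s \<in> carrier S; (p, q) \<in> ?r\<rbrakk> \<Longrightarrow> (free_act S s p, free_act S s q) \<in> ?r"
    unfolding act_congruence_def by auto
  have gen: "((x, \<one>), (x, a)) \<in> ?r"
    using hull_subset[of "{((x, \<one>), (x, a))}"] by blast
  have step: "((x, u), (x, u \<otimes> a)) \<in> ?r" if "u \<in> carrier S" for u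
    using comp[OF that gen] that by (simp add: free_act_def)
  have pow: "((x, u), (x, u \<otimes> a [^] (n::nat))) \<in> ?r" if u: "u \<in> carrier S" for u n
  proof (induction n)
    case 0
    then show ?case using u eqr by (simp add: equiv_def refl_on_def)
  next
    case (Suc n)
    moreover have "((x, u \<otimes> a [^] n), (x, u \<otimes> a [^] Suc n)) \<in> ?r"
      using step[of "u \<otimes> a [^] n"] u a by (simp add: m_assoc)
    ultimately show ?case using equiv_class_eq_iff[OF eqr] by metis
  qed
  show ?thesis
  proof
    assume "((x, s), (x, t)) \<in> ?r"
    then show "\<exists>(m::nat) (n::nat). s \<otimes> a [^] n = t \<otimes> a [^] m"
      using r_le unfolding R_def by blast
  next
    assume "\<exists>(m::nat) (n::nat). s \<otimes> a [^] n = t \<otimes> a [^] m"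
    then obtain m n :: nat where "s \<otimes> a [^] n = t \<otimes> a [^] m" by blast
    then have "((x, s), (x, t \<otimes> a [^] m)) \<in> ?r" using pow[OF s, of n] by simp
    then show "((x, s), (x, t)) \<in> ?r"
      using pow[OF t, of m] equiv_class_eq_iff[OF eqr] by metis
  qed
qed

lemma act_congruence_kernel_mult_right:
  fixes S :: "('a, 'm) monoid_scheme" (structure)
  assumes "monoid S" and c: "c \<in> carrier S"
  shows "act_congruence S (carrier S) (mult S)
    {(u, v). u \<in> carrier S \<and> v \<in> carrier S \<and> u \<otimes> c = v \<otimes> c}"
proof -
  interpret monoid S by fact
  show ?thesis
    using c unfolding act_congruence_def equiv_def refl_on_def sym_def trans_def
    by (auto simp: m_assoc)
qed

theorem lemma3p3:
  fixes M :: "('a, 'm) monoid_scheme" (structure) and a b :: 'a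
  assumes "monoid M" and "a \<in> carrier M" and "b \<in> carrier M"
    and "\<And>u v (m::nat) (n::nat). \<lbrakk>u \<in> carrier M; v \<in> carrier M;
        u \<otimes> b \<otimes> a [^] n = v \<otimes> b \<otimes> a [^] m\<rbrakk> \<Longrightarrow> u \<otimes> b \<otimes> a [^] n = v \<otimes> b \<otimes> a [^] n"
    and "\<And>i::nat. i \<ge> 1 \<Longrightarrow> \<exists>u\<in>carrier M. \<exists>v\<in>carrier M.
        u \<otimes> b \<otimes> a [^] i = v \<otimes> b \<otimes> a [^] i \<and> u \<otimes> b \<otimes> a [^] (i - 1) \<noteq> v \<otimes> b \<otimes> a [^] (i - 1)"
  shows "\<not> left_coherent M"
proof
  assume coh: "left_coherent M"
  interpret monoid M by fact
  note a = assms(2) and b = assms(3)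
  let ?F = "{0::nat} \<times> carrier M"
  define r where "r = act_congruence M ?F (free_act M) hull {((0, \<one>), (0, a))}"
  let ?q = "quotient_act (free_act M) r"
  define y where "y = r `` {(0, b)}"
  define B where "B = {?q s y | s. s \<in> carrier M}"
  have r_iff: "((0, s), (0, t)) \<in> r \<longleftrightarrow> (\<exists>(m::nat) (n::nat). s \<otimes> a [^] n = t \<otimes> a [^] m)"
    if "s \<in> carrier M" "t \<in> carrier M" for s t
    unfolding r_def using identify_one_iff[OF assms(1) a that] .
  have rel: "{((0, \<one>), (0, a))} \<subseteq> ?F \<times> ?F" using a by auto
  have congr: "act_congruence M ?F (free_act M) r"
    unfolding r_def by (rule act_congruence_hull[OF left_act_free[OF assms(1)] rel])
  then have eqr: "equiv ?F r" unfolding act_congruence_def by blast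
  have q_y: "?q s y = r `` {(0, s \<otimes> b)}" if "s \<in> carrier M" for s
    unfolding y_def using quotient_act_class[OF congr that, of "(0, b)"] b
    by (simp add: free_act_def)
  have q_eq: "?q u y = ?q v y \<longleftrightarrow> (\<exists>(m::nat) (n::nat). u \<otimes> b \<otimes> a [^] n = v \<otimes> b \<otimes> a [^] m)"
    if "u \<in> carrier M" "v \<in> carrier M" for u v
    using that b eq_equiv_class_iff[OF eqr, of "(0, u \<otimes> b)" "(0, v \<otimes> b)"] by (simp add: q_y r_iff)

  have "fg_act_congruence M ?F (free_act M) r"
    unfolding fg_act_congruence_def r_def
    by (intro exI[of _ "{((0, \<one>), (0, a))}"] conjI refl rel) simp
  then have "finitely_presented_act M (?F // r) ?q"
    by (intro finitely_presented_quotient_free assms(1)) auto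
  moreover have "y \<in> ?F // r" unfolding y_def using b by (auto intro: quotientI)
  then have "fg_subact M (?F // r) ?q B"
    unfolding fg_subact_def B_def by (intro exI[of _ "{y}"]) auto
  ultimately have fp: "finitely_presented_act M B ?q"
    by (rule left_coherentD[OF coh])

  define \<kappa> where "\<kappa> n = {(u, v). u \<in> carrier M \<and> v \<in> carrier M \<and>
    u \<otimes> (b \<otimes> a [^] n) = v \<otimes> (b \<otimes> a [^] n)}" for n :: nat
  have \<kappa>_iff: "(u, v) \<in> \<kappa> n \<longleftrightarrow> u \<otimes> b \<otimes> a [^] n = v \<otimes> b \<otimes> a [^] n"
    if "u \<in> carrier M" "v \<in> carrier M" for u v n
    using that a b unfolding \<kappa>_def by (simp add: m_assoc)
  have "\<exists>K. \<forall>u\<in>carrier M. \<forall>v\<in>carrier M. ?q u y = ?q v y \<longrightarrow> (u, v) \<in> \<kappa> K"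
  proof (rule annihilator_chain_stabilises[OF fp _ B_def])
    have "?q \<one> y = y" using b by (simp add: q_y) (simp add: y_def)
    then show "y \<in> B" unfolding B_def by force
    show "act_congruence M (carrier M) (\<otimes>) (\<kappa> n)" for n
      unfolding \<kappa>_def by (rule act_congruence_kernel_mult_right[OF assms(1)]) (use a b in simp)
    show "mono \<kappa>"
    proof (unfold mono_iff_le_Suc, clarify)
      fix n u v assume uv: "(u, v) \<in> \<kappa> n"
      then have car: "u \<in> carrier M" "v \<in> carrier M" unfolding \<kappa>_def by auto
      have "u \<otimes> b \<otimes> a [^] n \<otimes> a = v \<otimes> b \<otimes> a [^] n \<otimes> a" using uv car by (simp add: \<kappa>_iff)
      then show "(u, v) \<in> \<kappa> (Suc n)" using car a b by (simp add: \<kappa>_iff m_assoc)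
    qed
    show "\<exists>n. (u, v) \<in> \<kappa> n" if "u \<in> carrier M" "v \<in> carrier M" "?q u y = ?q v y" for u v
    proof -
      obtain m n :: nat where "u \<otimes> b \<otimes> a [^] n = v \<otimes> b \<otimes> a [^] m"
        using q_eq[OF \<open>u \<in> carrier M\<close> \<open>v \<in> carrier M\<close>] \<open>?q u y = ?q v y\<close> by blast
      then have "u \<otimes> b \<otimes> a [^] n = v \<otimes> b \<otimes> a [^] n"
        by (rule assms(4)[OF \<open>u \<in> carrier M\<close> \<open>v \<in> carrier M\<close>])
      then show ?thesis using \<kappa>_iff[OF \<open>u \<in> carrier M\<close> \<open>v \<in> carrier M\<close>] by blast
    qed
  qed
  then obtain K where K: "\<And>u v. \<lbrakk>u \<in> carrier M; v \<in> carrier M; ?q u y = ?q v y\<rbrakk> \<Longrightarrow> (u, v) \<in> \<kappa> K"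
    by blast
  obtain u v where uv: "u \<in> carrier M" "v \<in> carrier M"
      and "u \<otimes> b \<otimes> a [^] Suc K = v \<otimes> b \<otimes> a [^] Suc K"
      and neq: "u \<otimes> b \<otimes> a [^] K \<noteq> v \<otimes> b \<otimes> a [^] K"
    using assms(5)[of "Suc K"] by auto
  then have "?q u y = ?q v y" using q_eq by blast
  then have "(u, v) \<in> \<kappa> K" by (rule K[OF uv])
  then show False using \<kappa>_iff[OF uv] neq by blast
qed

end
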